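(* Let $A\subseteq B$ be an extension of unital associative algebras over a field $k$. Fix a vector space $V$ and an algebra extending structure $\Omega(A,V)=(\triangleleft,\triangleright,\leftharpoonup,\rightharpoonup,f,\cdot)$ of $A$ through $V$ such that $B\cong A\ltimes V$ via an algebra isomorphism sending $a\in A$ to $(a,0)$. Then $\mathbb{G}_A^V(\triangleleft,\triangleright,\leftharpoonup,\rightharpoonup,f,\cdot)$ is a subgroup of the semidirect product of groups $\mathbb{G}_A^V=\mathrm{GL}_k(V)\rtimes \mathrm{Hom}_k(V,A)$, and there exists an isomorphism of groups $$\mathrm{Gal}(B/A)\cong\mathbb{G}_A^V(\triangleleft,\triangleright,\leftharpoonup,\rightharpoonup,f,\cdot).$$
   Context: All vector spaces, linear and bilinear maps are over an arbitrary field $k$. "Algebra" means unital associative $k$-algebra; algebra maps preserve units. $\mathrm{Gal}(B/A)$ is the group of all algebra automorphisms $\sigma$ of $B$ with $\sigma(a)=a$ for all $a\in A$. An extending datum of $A$ through $V$ is a system $\Omega(A,V)=(\triangleleft,\triangleright,\leftharpoonup,\rightharpoonup,f,\cdot)$ of six bilinear maps $\triangleleft:V\times A\to V$, $\triangleright:V\times A\to A$, $\leftharpoonup:A\times V\to A$, $\rightharpoonup:A\times V\to V$, $f:V\times V\to A$, $\cdot:V\times V\to V$. Let $A\ltimes V$ be the vector space $A\times V$ with multiplication $$(a,x)\bullet(b,y)=\bigl(ab+a\leftharpoonup y+x\triangleright b+f(x,y),\ a\rightharpoonup y+x\triangleleft b+x\cdot y\bigr).$$ If this is associative with unit $(1_A,0_V)$,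 then $\Omega(A,V)$ is called an algebra extending structure of $A$ through $V$. $\mathbb{G}_A^V$ is the set $\mathrm{Hom}_k(V,A)\times\mathrm{GL}_k(V)$ with group law $(r,\sigma)\cdot(r',\sigma')=(r'+r\circ\sigma',\ \sigma\circ\sigma')$; it is the semidirect product $\mathrm{GL}_k(V)\rtimes\mathrm{Hom}_k(V,A)$ of its subgroup $\{0\}\times \mathrm{GL}_k(V)$ and its abelian normal subgroup $\mathrm{Hom}_k(V,A)\times\{\mathrm{Id}_V\}$. $\mathbb{G}_A^V(\triangleleft,\triangleright,\leftharpoonup,\rightharpoonup,f,\cdot)$ is the set of all pairs $(r,\sigma)\in\mathbb{G}_A^V$ such that for all $a\in A$, $x,y\in V$: $f(x,y)=f(\sigma(x),\sigma(y))+r(x)r(y)-r(x\cdot y)+r(x)\leftharpoonup\sigma(y)+\sigma(x)\triangleright r(y)$; $\sigma(x\cdot y)=\sigma(x)\cdot\sigma(y)+r(x)\rightharpoonup\sigma(y)+\sigma(x)\triangleleft r(y)$; $r(x\triangleleft a)=r(x)a-x\triangleright a+\sigma(x)\triangleright a$; $r(a\rightharpoonup x)=a\,r(x)-a\leftharpoonup x+a\leftharpoonup\sigma(x)$; $\sigma(x\triangleleft a)=\sigma(x)\triangleleft a$ and $\sigma(a\rightharpoonup x)=a\rightharpoonup\sigma(x)$. *)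

theory Defs
  imports Complex_Main "HOL-Algebra.Coset" "HOL-Library.Product_Plus"
begin

text \<open>
  The sort \<open>{ring, monoid_mult}\<close> is used instead of \<open>ring_1\<close> because the latter requires
  \<open>0 \<noteq> 1\<close> and would exclude the zero algebra.
\<close>

locale assoc_unital_algebra = vector_space scale
  for scale :: "'k::field \<Rightarrow> 'b::{ring,monoid_mult} \<Rightarrow> 'b" +
  assumes scale_mult_left: "scale c x * y = scale c (x * y)"
    and scale_mult_right: "x * scale c y = scale c (x * y)"
begin

definition unital_subalgebra :: "'b set \<Rightarrow> bool" where
  "unital_subalgebra A \<longleftrightarrow> subspace A \<and> 1 \<in> A \<and> (\<forall>a\<in>A. \<forall>b\<in>A. a * b \<in> A)"

end

definition Gal :: "('k::field \<Rightarrow> 'b::{ring,monoid_mult} \<Rightarrow> 'b) \<Rightarrow> 'b set \<Rightarrow> ('b \<Rightarrow> 'b) monoid" where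
  "Gal scale A = \<lparr>
     carrier = {\<sigma>. Vector_Spaces.linear scale scale \<sigma> \<and> bij \<sigma> \<and>
                   (\<forall>x y. \<sigma> (x * y) = \<sigma> x * \<sigma> y) \<and> \<sigma> 1 = 1 \<and> (\<forall>a\<in>A. \<sigma> a = a)},
     mult = (\<circ>), one = id\<rparr>"

text \<open>Bilinearity of a map \<open>X \<times> Y \<rightarrow> Z\<close>, for subspaces \<open>X\<close>, \<open>Y\<close>, \<open>Z\<close> of the ambient types.\<close>

definition bilinear_on ::
  "('k::field \<Rightarrow> 'x::ab_group_add \<Rightarrow> 'x) \<Rightarrow> 'x set \<Rightarrow> ('k \<Rightarrow> 'y::ab_group_add \<Rightarrow> 'y) \<Rightarrow> 'y set \<Rightarrow>
   ('k \<Rightarrow> 'z::ab_group_add \<Rightarrow> 'z) \<Rightarrow> 'z set \<Rightarrow> ('x \<Rightarrow> 'y \<Rightarrow> 'z) \<Rightarrow> bool" where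
  "bilinear_on sX X sY Y sZ Z h \<longleftrightarrow>
     (\<forall>x\<in>X. \<forall>y\<in>Y. h x y \<in> Z) \<and>
     (\<forall>x\<in>X. \<forall>x'\<in>X. \<forall>y\<in>Y. h (x + x') y = h x y + h x' y) \<and>
     (\<forall>x\<in>X. \<forall>y\<in>Y. \<forall>y'\<in>Y. h x (y + y') = h x y + h x y') \<and>
     (\<forall>c. \<forall>x\<in>X. \<forall>y\<in>Y. h (sX c x) y = sZ c (h x y)) \<and>
     (\<forall>c. \<forall>x\<in>X. \<forall>y\<in>Y. h x (sY c y) = sZ c (h x y))"

text \<open>
  The algebra \<open>A\<close> is a subset of a type \<open>'a\<close>, while \<open>V\<close> is the whole type \<open>'v\<close>. The values of the
  maps below on arguments of type \<open>'a\<close> outside \<open>A\<close> are irrelevant.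
\<close>

record ('a, 'v) extending_datum =
  right_act :: "'v \<Rightarrow> 'a \<Rightarrow> 'v" (infixl \<open>\<triangleleft>\<index>\<close> 75)
  right_harp_A :: "'v \<Rightarrow> 'a \<Rightarrow> 'a" (infixl \<open>\<triangleright>\<index>\<close> 75)
  left_harp_A :: "'a \<Rightarrow> 'v \<Rightarrow> 'a" (infixl \<open>\<leftharpoonup>\<index>\<close> 75)
  left_act :: "'a \<Rightarrow> 'v \<Rightarrow> 'v" (infixl \<open>\<rightharpoonup>\<index>\<close> 75)
  cocycle :: "'v \<Rightarrow> 'v \<Rightarrow> 'a" (\<open>\<f>\<index>\<close>)
  mult_V :: "'v \<Rightarrow> 'v \<Rightarrow> 'v" (infixl \<open>\<cdot>\<index>\<close> 75)

definition is_extending_datum ::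
  "('k::field \<Rightarrow> 'a::{ring,monoid_mult} \<Rightarrow> 'a) \<Rightarrow> 'a set \<Rightarrow> ('k \<Rightarrow> 'v::ab_group_add \<Rightarrow> 'v) \<Rightarrow>
   ('a, 'v) extending_datum \<Rightarrow> bool" where
  "is_extending_datum sA A sV \<Omega> \<longleftrightarrow>
     bilinear_on sV UNIV sA A sV UNIV (right_act \<Omega>) \<and>
     bilinear_on sV UNIV sA A sA A (right_harp_A \<Omega>) \<and>
     bilinear_on sA A sV UNIV sA A (left_harp_A \<Omega>) \<and>
     bilinear_on sA A sV UNIV sV UNIV (left_act \<Omega>) \<and>
     bilinear_on sV UNIV sV UNIV sA A (cocycle \<Omega>) \<and>
     bilinear_on sV UNIV sV UNIV sV UNIV (mult_V \<Omega>)"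

text \<open>The multiplicative structure of \<open>A \<ltimes> V\<close>.\<close>

definition unified_product ::
  "'a::{ring,monoid_mult} set \<Rightarrow> ('a, 'v::ab_group_add) extending_datum \<Rightarrow> ('a \<times> 'v) monoid" where
  "unified_product A \<Omega> = \<lparr>
     carrier = A \<times> UNIV,
     mult = (\<lambda>(a, x) (b, y).
       (a * b + a \<leftharpoonup>\<^bsub>\<Omega>\<^esub> y + x \<triangleright>\<^bsub>\<Omega>\<^esub> b + \<f>\<^bsub>\<Omega>\<^esub> x y,
        a \<rightharpoonup>\<^bsub>\<Omega>\<^esub> y + x \<triangleleft>\<^bsub>\<Omega>\<^esub> b + x \<cdot>\<^bsub>\<Omega>\<^esub> y)),
     one = (1, 0)\<rparr>"

definition algebra_extending_structure ::
  "('k::field \<Rightarrow> 'a::{ring,monoid_mult} \<Rightarrow> 'a) \<Rightarrow> 'a set \<Rightarrow> ('k \<Rightarrow> 'v::ab_group_add \<Rightarrow> 'v) \<Rightarrow>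
   ('a, 'v) extending_datum \<Rightarrow> bool" where
  "algebra_extending_structure sA A sV \<Omega> \<longleftrightarrow>
     is_extending_datum sA A sV \<Omega> \<and> monoid (unified_product A \<Omega>)"

text \<open>
  Algebra isomorphisms from the algebra \<open>B\<close> (the whole type \<open>'a\<close>) onto \<open>A \<ltimes> V\<close>, whose vector space
  structure is that of \<open>A \<times> V\<close>.
\<close>

definition unified_product_iso ::
  "('k::field \<Rightarrow> 'a::{ring,monoid_mult} \<Rightarrow> 'a) \<Rightarrow> 'a set \<Rightarrow> ('k \<Rightarrow> 'v::ab_group_add \<Rightarrow> 'v) \<Rightarrow>
   ('a, 'v) extending_datum \<Rightarrow> ('a \<Rightarrow> 'a \<times> 'v) \<Rightarrow> bool" where
  "unified_product_iso sB A sV \<Omega> \<phi> \<longleftrightarrow>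
     Vector_Spaces.linear sB (\<lambda>c (a, x). (sB c a, sV c x)) \<phi> \<and>
     bij_betw \<phi> UNIV (carrier (unified_product A \<Omega>)) \<and>
     (\<forall>b b'. \<phi> (b * b') = \<phi> b \<otimes>\<^bsub>unified_product A \<Omega>\<^esub> \<phi> b') \<and>
     \<phi> 1 = \<one>\<^bsub>unified_product A \<Omega>\<^esub>"

definition Hom_VA ::
  "('k::field \<Rightarrow> 'a::{ring,monoid_mult} \<Rightarrow> 'a) \<Rightarrow> 'a set \<Rightarrow> ('k \<Rightarrow> 'v::ab_group_add \<Rightarrow> 'v) \<Rightarrow>
   ('v \<Rightarrow> 'a) set" where
  "Hom_VA sA A sV = {r. Vector_Spaces.linear sV sA r \<and> range r \<subseteq> A}"

definition GL_V :: "('k::field \<Rightarrow> 'v::ab_group_add \<Rightarrow> 'v) \<Rightarrow> ('v \<Rightarrow> 'v) set" where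
  "GL_V sV = {\<sigma>. Vector_Spaces.linear sV sV \<sigma> \<and> bij \<sigma>}"

definition G_AV ::
  "('k::field \<Rightarrow> 'a::{ring,monoid_mult} \<Rightarrow> 'a) \<Rightarrow> 'a set \<Rightarrow> ('k \<Rightarrow> 'v::ab_group_add \<Rightarrow> 'v) \<Rightarrow>
   (('v \<Rightarrow> 'a) \<times> ('v \<Rightarrow> 'v)) monoid" where
  "G_AV sA A sV = \<lparr>
     carrier = Hom_VA sA A sV \<times> GL_V sV,
     mult = (\<lambda>(r, \<sigma>) (r', \<sigma>'). (\<lambda>x. r' x + r (\<sigma>' x), \<sigma> \<circ> \<sigma>')),
     one = (\<lambda>_. 0, id)\<rparr>"

definition G_AV_datum ::
  "('k::field \<Rightarrow> 'a::{ring,monoid_mult} \<Rightarrow> 'a) \<Rightarrow> 'a set \<Rightarrow> ('k \<Rightarrow> 'v::ab_group_add \<Rightarrow> 'v) \<Rightarrow>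
   ('a, 'v) extending_datum \<Rightarrow> (('v \<Rightarrow> 'a) \<times> ('v \<Rightarrow> 'v)) set" where
  "G_AV_datum sA A sV \<Omega> = {(r, \<sigma>) \<in> carrier (G_AV sA A sV).
     (\<forall>x y. \<f>\<^bsub>\<Omega>\<^esub> x y = \<f>\<^bsub>\<Omega>\<^esub> (\<sigma> x) (\<sigma> y) + r x * r y - r (x \<cdot>\<^bsub>\<Omega>\<^esub> y)
        + (r x) \<leftharpoonup>\<^bsub>\<Omega>\<^esub> (\<sigma> y) + (\<sigma> x) \<triangleright>\<^bsub>\<Omega>\<^esub> (r y)) \<and>
     (\<forall>x y. \<sigma> (x \<cdot>\<^bsub>\<Omega>\<^esub> y) = (\<sigma> x) \<cdot>\<^bsub>\<Omega>\<^esub> (\<sigma> y) + (r x) \<rightharpoonup>\<^bsub>\<Omega>\<^esub> (\<sigma> y) + (\<sigma> x) \<triangleleft>\<^bsub>\<Omega>\<^esub> (r y)) \<and>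
     (\<forall>a\<in>A. \<forall>x. r (x \<triangleleft>\<^bsub>\<Omega>\<^esub> a) = r x * a - x \<triangleright>\<^bsub>\<Omega>\<^esub> a + (\<sigma> x) \<triangleright>\<^bsub>\<Omega>\<^esub> a) \<and>
     (\<forall>a\<in>A. \<forall>x. r (a \<rightharpoonup>\<^bsub>\<Omega>\<^esub> x) = a * r x - a \<leftharpoonup>\<^bsub>\<Omega>\<^esub> x + a \<leftharpoonup>\<^bsub>\<Omega>\<^esub> (\<sigma> x)) \<and>
     (\<forall>a\<in>A. \<forall>x. \<sigma> (x \<triangleleft>\<^bsub>\<Omega>\<^esub> a) = (\<sigma> x) \<triangleleft>\<^bsub>\<Omega>\<^esub> a) \<and>
     (\<forall>a\<in>A. \<forall>x. \<sigma> (a \<rightharpoonup>\<^bsub>\<Omega>\<^esub> x) = a \<rightharpoonup>\<^bsub>\<Omega>\<^esub> (\<sigma> x))}"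

text \<open>\<open>G\<close> is the internal semidirect product \<open>H \<rtimes> N\<close>, with \<open>N\<close> the normal factor.\<close>

definition is_semidirect_product :: "('g, 'm) monoid_scheme \<Rightarrow> 'g set \<Rightarrow> 'g set \<Rightarrow> bool" where
  "is_semidirect_product G H N \<longleftrightarrow>
     group G \<and> subgroup H G \<and> N \<lhd> G \<and> H \<inter> N = {\<one>\<^bsub>G\<^esub>} \<and> H <#>\<^bsub>G\<^esub> N = carrier G"

end

theory Submission
  imports Defs
begin

text \<open>
  The isomorphism \<open>B \<cong> A \<ltimes> V\<close> splits \<open>B = A \<oplus> \<iota> V\<close>. An endomorphism \<open>T\<close> of the vector space
  \<open>B\<close> that is the identity on \<open>A\<close> is determined by \<open>T (\<iota> x) = r x + \<iota> (\<sigma> x)\<close>, and composition of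
  such maps is the group law of pairs \<open>(r, \<sigma>)\<close>. Comparing the \<open>A\<close>- and \<open>V\<close>-components of
  \<open>T (b * c) = T b * T c\<close> for \<open>b\<close>, \<open>c\<close> in \<open>A\<close> or \<open>\<iota> V\<close> gives exactly the six identities required
  of \<open>(r, \<sigma>)\<close>, so these pairs form the preimage of the Galois group.
\<close>

section \<open>The Galois group\<close>

lemma linear_inv_into:
  assumes "Vector_Spaces.linear s t f" "bij f"
  shows "Vector_Spaces.linear t s (inv_into UNIV f)"
  using assms by (metis bij_module_hom_imp_inv_module_hom module_hom_iff_linear)

lemma mult_Gal: "S \<otimes>\<^bsub>Gal s A\<^esub> T = S \<circ> T"
  by (simp add: Gal_def)

text \<open>Stated for the inverse function instead of the group inverse: it supplies the inverses
  in \<open>group_Gal\<close>, and the later arguments also work with inverses of maps.\<close>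

lemma (in assoc_unital_algebra) Gal_inv_closed:
  assumes "T \<in> carrier (Gal scale A)"
  shows "inv_into UNIV T \<in> carrier (Gal scale A)"
proof -
  have b: "bij T" and l: "Vector_Spaces.linear scale scale T"
    and m: "\<And>x y. T (x * y) = T x * T y" and o: "T 1 = 1" and f: "\<And>a. a \<in> A \<Longrightarrow> T a = a"
    using assms by (auto simp: Gal_def)
  have Ti: "T (inv_into UNIV T y) = y" and iT: "inv_into UNIV T (T x) = x" for x y
    using b by (simp_all add: bij_is_surj surj_f_inv_f bij_is_inj)
  have "inv_into UNIV T (x * y) = inv_into UNIV T x * inv_into UNIV T y" for x y
    by (metis iT Ti m)
  moreover have "inv_into UNIV T 1 = 1" and "\<And>a. a \<in> A \<Longrightarrow> inv_into UNIV T a = a"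
    by (metis iT o, metis iT f)
  ultimately show ?thesis
    using b linear_inv_into[OF l b] by (simp add: Gal_def bij_imp_bij_inv)
qed

lemma (in assoc_unital_algebra) group_Gal: "group (Gal scale A)"
proof (rule groupI)
  fix S T assume "S \<in> carrier (Gal scale A)" "T \<in> carrier (Gal scale A)"
  then show "S \<otimes>\<^bsub>Gal scale A\<^esub> T \<in> carrier (Gal scale A)"
    by (auto simp: Gal_def bij_comp intro: Vector_Spaces.linear_compose)
next
  show "\<one>\<^bsub>Gal scale A\<^esub> \<in> carrier (Gal scale A)"
    by (simp add: Gal_def linear_id)
next
  fix T assume T: "T \<in> carrier (Gal scale A)"
  then have "inj T"
    by (auto simp: Gal_def bij_is_inj)
  with Gal_inv_closed[OF T]
  show "\<exists>S\<in>carrier (Gal scale A). S \<otimes>\<^bsub>Gal scale A\<^esub> T = \<one>\<^bsub>Gal scale A\<^esub>"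
    by (intro bexI[of _ "inv_into UNIV T"]) (auto simp: Gal_def)
qed (simp_all add: Gal_def o_assoc)

section \<open>The group of pairs (r, \<sigma>) and its semidirect decomposition\<close>

locale space_and_subspace = B: vector_space sB + V: vector_space sV
  for sB :: "'k::field \<Rightarrow> 'b::{ring,monoid_mult} \<Rightarrow> 'b" and sV :: "'k \<Rightarrow> 'v::ab_group_add \<Rightarrow> 'v" +
  fixes A :: "'b set"
  assumes subspace_A: "B.subspace A"
begin

abbreviation "G \<equiv> G_AV sB A sV"

lemmas A_zero [simp] = B.subspace_0[OF subspace_A]
  and A_add [simp] = B.subspace_add[OF subspace_A]
  and A_neg [simp] = B.subspace_neg[OF subspace_A]

lemma carrier_G_iff:
  "(r, \<sigma>) \<in> carrier G \<longleftrightarrow>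
     Vector_Spaces.linear sV sB r \<and> (\<forall>x. r x \<in> A) \<and> Vector_Spaces.linear sV sV \<sigma> \<and> bij \<sigma>"
  by (auto simp: G_AV_def Hom_VA_def GL_V_def)

lemma mult_G: "(r, \<sigma>) \<otimes>\<^bsub>G\<^esub> (r', \<sigma>') = (\<lambda>x. r' x + r (\<sigma>' x), \<sigma> \<circ> \<sigma>')"
  by (simp add: G_AV_def)

lemma one_G: "\<one>\<^bsub>G\<^esub> = (\<lambda>_. 0, id)"
  by (simp add: G_AV_def)

lemma mult_G_closed:
  assumes "g \<in> carrier G" "h \<in> carrier G"
  shows "g \<otimes>\<^bsub>G\<^esub> h \<in> carrier G"
proof -
  obtain r \<sigma> r' \<sigma>' where gh: "g = (r, \<sigma>)" "h = (r', \<sigma>')"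
    by (metis surj_pair)
  have "Vector_Spaces.linear sV sB (\<lambda>x. r' x + r (\<sigma>' x))"
    using assms by (simp add: gh carrier_G_iff Vector_Spaces.linear_iff B.scale_right_distrib)
  then show ?thesis
    using assms by (auto simp: gh carrier_G_iff mult_G bij_comp intro: Vector_Spaces.linear_compose)
qed

lemma one_G_closed: "\<one>\<^bsub>G\<^esub> \<in> carrier G"
  by (simp add: one_G carrier_G_iff V.linear_id Vector_Spaces.linear_iff B.vector_space_axioms V.vector_space_axioms)

text \<open>The formula is forced: (r', \<sigma>') times (r, \<sigma>) has components r + r' \<circ>
  \<sigma> and \<sigma>' \<circ> \<sigma>, so being the unit means that \<sigma>' inverts \<sigma>
  and that r' is -r composed with this inverse.\<close>

lemma inv_G_closed:
  assumes "(r, \<sigma>) \<in> carrier G"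
  shows "(\<lambda>x. - r (inv_into UNIV \<sigma> x), inv_into UNIV \<sigma>) \<in> carrier G"
proof -
  have l: "Vector_Spaces.linear sV sV (inv_into UNIV \<sigma>)"
    using assms by (simp add: carrier_G_iff linear_inv_into)
  moreover have "Vector_Spaces.linear sV sB (\<lambda>x. - r (inv_into UNIV \<sigma> x))"
    using l assms by (simp add: carrier_G_iff Vector_Spaces.linear_iff)
  ultimately show ?thesis
    using assms by (simp add: carrier_G_iff bij_imp_bij_inv)
qed

lemma inv_G_mult:
  assumes "(r, \<sigma>) \<in> carrier G"
  shows "(\<lambda>x. - r (inv_into UNIV \<sigma> x), inv_into UNIV \<sigma>) \<otimes>\<^bsub>G\<^esub> (r, \<sigma>) = \<one>\<^bsub>G\<^esub>"
proof -
  have "inj \<sigma>"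
    using assms by (simp add: carrier_G_iff bij_is_inj)
  then show ?thesis
    by (simp add: mult_G one_G)
qed

lemma group_G: "group G"
proof (rule groupI)
  fix g h k assume g: "g \<in> carrier G" "h \<in> carrier G" "k \<in> carrier G"
  obtain r \<sigma> r' \<sigma>' r'' \<sigma>'' where ghk: "g = (r, \<sigma>)" "h = (r', \<sigma>')" "k = (r'', \<sigma>'')"
    by (metis surj_pair)
  show "g \<otimes>\<^bsub>G\<^esub> h \<otimes>\<^bsub>G\<^esub> k = g \<otimes>\<^bsub>G\<^esub> (h \<otimes>\<^bsub>G\<^esub> k)"
    by (simp add: ghk mult_G o_assoc add.assoc)
next
  fix g assume g: "g \<in> carrier G"
  obtain r \<sigma> where r: "g = (r, \<sigma>)"
    by (metis surj_pair)
  show "\<exists>h\<in>carrier G. h \<otimes>\<^bsub>G\<^esub> g = \<one>\<^bsub>G\<^esub>"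
    using inv_G_closed inv_G_mult g unfolding r by blast
  show "\<one>\<^bsub>G\<^esub> \<otimes>\<^bsub>G\<^esub> g = g"
    by (simp add: r mult_G one_G)
qed (simp_all add: mult_G_closed one_G_closed)

sublocale G: group G
  by (rule group_G)

lemma inv_G:
  assumes "(r, \<sigma>) \<in> carrier G"
  shows "inv\<^bsub>G\<^esub> (r, \<sigma>) = (\<lambda>x. - r (inv_into UNIV \<sigma> x), inv_into UNIV \<sigma>)"
  using inv_G_mult inv_G_closed assms by (metis G.inv_equality)

lemma GL_subgroup: "subgroup ({\<lambda>_. 0} \<times> GL_V sV) G"
proof (rule G.subgroupI)
  show sub: "{\<lambda>_. 0} \<times> GL_V sV \<subseteq> carrier G"
    by (auto simp: carrier_G_iff GL_V_def Vector_Spaces.linear_iff B.vector_space_axioms)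
  show "{\<lambda>_. 0 :: 'b} \<times> GL_V sV \<noteq> {}"
    using V.linear_id by (auto simp: GL_V_def)
  show "inv\<^bsub>G\<^esub> g \<in> {\<lambda>_. 0} \<times> GL_V sV" if "g \<in> {\<lambda>_. 0} \<times> GL_V sV" for g
    using that subsetD[OF sub that]
    by (auto simp: inv_G GL_V_def linear_inv_into bij_imp_bij_inv)
  show "g \<otimes>\<^bsub>G\<^esub> h \<in> {\<lambda>_. 0} \<times> GL_V sV"
    if "g \<in> {\<lambda>_. 0} \<times> GL_V sV" "h \<in> {\<lambda>_. 0} \<times> GL_V sV" for g h
    using that by (auto simp: mult_G GL_V_def bij_comp intro: Vector_Spaces.linear_compose)
qed

text \<open>This set is the kernel of the multiplicative projection \<open>snd\<close> onto GL(V).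
  Under \<open>snd\<close> a conjugate of one of its elements becomes \<sigma> followed or preceded
  by its inverse, that is \<open>id\<close>.\<close>

lemma Hom_normal: "Hom_VA sB A sV \<times> {id} \<lhd> G"
  unfolding G.normal_inv_iff
proof (intro conjI ballI G.subgroupI)
  show sub: "Hom_VA sB A sV \<times> {id} \<subseteq> carrier G"
    by (auto simp: carrier_G_iff Hom_VA_def V.linear_id image_subset_iff)
  show "Hom_VA sB A sV \<times> {id} \<noteq> ({} :: (('v \<Rightarrow> 'b) \<times> ('v \<Rightarrow> 'v)) set)"
    using one_G_closed by (auto simp: one_G G_AV_def)
  have N_iff: "g \<in> Hom_VA sB A sV \<times> {id} \<longleftrightarrow> g \<in> carrier G \<and> snd g = id" for g
    using sub by (auto simp: G_AV_def)
  have snd_mult: "snd (g \<otimes>\<^bsub>G\<^esub> h) = snd g \<circ> snd h" for g h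
    by (cases g; cases h) (simp add: mult_G)
  have snd_inv: "snd (inv\<^bsub>G\<^esub> g) = inv_into UNIV (snd g)" if "g \<in> carrier G" for g
    using that by (cases g) (simp add: inv_G)
  have snd_surj: "surj (snd g)" if "g \<in> carrier G" for g
    using that by (cases g) (simp add: carrier_G_iff bij_is_surj)
  show "inv\<^bsub>G\<^esub> g \<in> Hom_VA sB A sV \<times> {id}" if "g \<in> Hom_VA sB A sV \<times> {id}" for g
    using that by (simp add: N_iff snd_inv)
  show "g \<otimes>\<^bsub>G\<^esub> h \<in> Hom_VA sB A sV \<times> {id}"
    if "g \<in> Hom_VA sB A sV \<times> {id}" "h \<in> Hom_VA sB A sV \<times> {id}" for g h
    using that by (simp add: N_iff snd_mult)
  show "g \<otimes>\<^bsub>G\<^esub> h \<otimes>\<^bsub>G\<^esub> inv\<^bsub>G\<^esub> g \<in> Hom_VA sB A sV \<times> {id}"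
    if "g \<in> carrier G" "h \<in> Hom_VA sB A sV \<times> {id}" for g h
    using that snd_surj[of g] by (simp add: N_iff snd_mult snd_inv surj_iff)
qed

lemma semidirect_product_G:
  "is_semidirect_product G ({\<lambda>_. 0} \<times> GL_V sV) (Hom_VA sB A sV \<times> {id})"
proof -
  let ?H = "{\<lambda>_. 0} \<times> GL_V sV" and ?N = "Hom_VA sB A sV \<times> {id}"
  have "?H \<inter> ?N = {\<one>\<^bsub>G\<^esub>}"
    using G.one_closed by (auto simp: one_G G_AV_def)
  moreover have "?H <#>\<^bsub>G\<^esub> ?N = carrier G"
  proof
    show "?H <#>\<^bsub>G\<^esub> ?N \<subseteq> carrier G"
      using subgroup.subset[OF GL_subgroup] subgroup.subset[OF normal_imp_subgroup[OF Hom_normal]]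
      by (rule G.set_mult_closed)
    show "carrier G \<subseteq> ?H <#>\<^bsub>G\<^esub> ?N"
    proof
      fix g assume "g \<in> carrier G"
      then obtain r \<sigma> where "g = (r, \<sigma>)" "r \<in> Hom_VA sB A sV" "\<sigma> \<in> GL_V sV"
        by (auto simp: G_AV_def)
      moreover from this have "g = (\<lambda>_. 0, \<sigma>) \<otimes>\<^bsub>G\<^esub> (r, id)"
        by (simp add: mult_G)
      ultimately show "g \<in> ?H <#>\<^bsub>G\<^esub> ?N"
        unfolding set_mult_def by blast
    qed
  qed
  ultimately show ?thesis
    using GL_subgroup Hom_normal group_G by (simp add: is_semidirect_product_def)
qed

end

section \<open>Extensions of A split by a linear section\<close>

text \<open>The isomorphism with the unified product is replaced by a section \<iota> and a
  projection \<pi>, so that all computations take place inside B. The last three assumptions are the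
  multiplication of the unified product on products with a factor in the image of \<iota>.\<close>

locale split_extension =
  space_and_subspace sB sV A + assoc_unital_algebra sB
  for sB :: "'k::field \<Rightarrow> 'b::{ring,monoid_mult} \<Rightarrow> 'b" and sV :: "'k \<Rightarrow> 'v::ab_group_add \<Rightarrow> 'v"
    and A :: "'b set" +
  fixes \<Omega> :: "('b, 'v) extending_datum" (structure)
    and \<iota> :: "'v \<Rightarrow> 'b" and \<pi> :: "'b \<Rightarrow> 'v"
  assumes one_A [simp]: "1 \<in> A"
    and mult_A [simp]: "a \<in> A \<Longrightarrow> b \<in> A \<Longrightarrow> a * b \<in> A"
    and right_harp_A_closed [simp]: "a \<in> A \<Longrightarrow> x \<triangleright> a \<in> A"
    and left_harp_A_closed [simp]: "a \<in> A \<Longrightarrow> a \<leftharpoonup> x \<in> A"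
    and cocycle_closed [simp]: "\<f> x y \<in> A"
    and linear_\<iota>: "Vector_Spaces.linear sV sB \<iota>"
    and linear_\<pi>: "Vector_Spaces.linear sB sV \<pi>"
    and \<pi>_A [simp]: "a \<in> A \<Longrightarrow> \<pi> a = 0"
    and \<pi>_\<iota> [simp]: "\<pi> (\<iota> x) = x"
    and A_part [simp]: "b - \<iota> (\<pi> b) \<in> A"
    and A_mult_\<iota>: "a \<in> A \<Longrightarrow> a * \<iota> x = a \<leftharpoonup> x + \<iota> (a \<rightharpoonup> x)"
    and \<iota>_mult_A: "a \<in> A \<Longrightarrow> \<iota> x * a = x \<triangleright> a + \<iota> (x \<triangleleft> a)"
    and \<iota>_mult_\<iota>: "\<iota> x * \<iota> y = \<f> x y + \<iota> (x \<cdot> y)"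
begin

interpretation \<iota>: Vector_Spaces.linear sV sB \<iota> by (rule linear_\<iota>)
interpretation \<pi>: Vector_Spaces.linear sB sV \<pi> by (rule linear_\<pi>)

lemma decomposition:
  obtains a x where "a \<in> A" "b = a + \<iota> x"
  by (metis A_part diff_add_cancel)

lemma decomposition_unique:
  assumes "a \<in> A" "b \<in> A"
  shows "a + \<iota> x = b + \<iota> y \<longleftrightarrow> a = b \<and> x = y"
proof
  assume eq: "a + \<iota> x = b + \<iota> y"
  then have "\<pi> (a + \<iota> x) = \<pi> (b + \<iota> y)" by simp
  then have "x = y" using assms by (simp add: \<pi>.add)
  with eq show "a = b \<and> x = y" by simp
qed simp

section \<open>Endomorphisms of B attached to pairs (r, \<sigma>)\<close>

fun gal_map :: "('v \<Rightarrow> 'b) \<times> ('v \<Rightarrow> 'v) \<Rightarrow> 'b \<Rightarrow> 'b" where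
  "gal_map (r, \<sigma>) b = b - \<iota> (\<pi> b) + (r (\<pi> b) + \<iota> (\<sigma> (\<pi> b)))"

declare gal_map.simps [simp del]

text \<open>The working form of \<open>gal_map\<close>. The definition writes the A-component of b
  as \<open>b - \<iota> (\<pi> b)\<close>, which avoids choosing a decomposition and makes linearity
  visible.\<close>

lemma gal_map_decomposed:
  assumes "(r, \<sigma>) \<in> carrier G" "a \<in> A"
  shows "gal_map (r, \<sigma>) (a + \<iota> x) = a + (r x + \<iota> (\<sigma> x))"
  using assms by (simp add: gal_map.simps \<pi>.add)

lemma linear_gal_map:
  assumes "(r, \<sigma>) \<in> carrier G"
  shows "Vector_Spaces.linear sB sB (gal_map (r, \<sigma>))"
proof -
  interpret r: Vector_Spaces.linear sV sB r
    using assms by (simp add: carrier_G_iff)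
  interpret \<sigma>: Vector_Spaces.linear sV sV \<sigma>
    using assms by (simp add: carrier_G_iff)
  show ?thesis
    unfolding Vector_Spaces.linear_iff
    by (simp add: gal_map.simps \<pi>.add \<iota>.add r.add \<sigma>.add \<pi>.scale \<iota>.scale r.scale \<sigma>.scale
        B.scale_right_distrib B.scale_right_diff_distrib B.vector_space_axioms)
qed

lemma gal_map_A:
  assumes "(r, \<sigma>) \<in> carrier G" "a \<in> A"
  shows "gal_map (r, \<sigma>) a = a"
proof -
  have "r 0 = 0" "\<sigma> 0 = 0"
    using assms(1)
    by (simp_all add: carrier_G_iff flip: module_hom_iff_linear) (metis module_hom.zero)+
  then show ?thesis
    using assms by (simp add: gal_map.simps)
qed

lemma gal_map_\<iota>:
  "(r, \<sigma>) \<in> carrier G \<Longrightarrow> gal_map (r, \<sigma>) (\<iota> x) = r x + \<iota> (\<sigma> x)"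
  by (simp add: gal_map.simps)

text \<open>The map of h sends a + \<iota> x to (a + r' x) + \<iota> (\<sigma>' x). The map of g
  fixes the first summand and adds r (\<sigma>' x) from the second, which yields the component r' +
  r \<circ> \<sigma>' of the group law.\<close>

lemma gal_map_mult:
  assumes "g \<in> carrier G" "h \<in> carrier G"
  shows "gal_map (g \<otimes>\<^bsub>G\<^esub> h) = gal_map g \<circ> gal_map h"
proof
  fix b
  obtain r \<sigma> r' \<sigma>' where gh: "g = (r, \<sigma>)" "h = (r', \<sigma>')"
    by (metis surj_pair)
  obtain a x where b: "a \<in> A" "b = a + \<iota> x"
    by (rule decomposition)
  have r': "r' x \<in> A"
    using assms by (simp add: gh carrier_G_iff)
  have "gal_map (g \<otimes>\<^bsub>G\<^esub> h) b = a + (r' x + r (\<sigma>' x) + \<iota> (\<sigma> (\<sigma>' x)))"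
    using gal_map_decomposed[of "\<lambda>x. r' x + r (\<sigma>' x)" "\<sigma> \<circ> \<sigma>'" a x] mult_G_closed[OF assms] b
    by (simp add: gh mult_G)
  also have "\<dots> = gal_map g ((a + r' x) + \<iota> (\<sigma>' x))"
    using gal_map_decomposed[of r \<sigma> "a + r' x" "\<sigma>' x"] assms b r' by (simp add: gh add.assoc)
  also have "(a + r' x) + \<iota> (\<sigma>' x) = gal_map h b"
    using gal_map_decomposed[of r' \<sigma>' a x] assms b by (simp add: gh add.assoc)
  finally show "gal_map (g \<otimes>\<^bsub>G\<^esub> h) b = (gal_map g \<circ> gal_map h) b"
    by simp
qed

lemma gal_map_one: "gal_map \<one>\<^bsub>G\<^esub> = id"
  by (auto simp: one_G gal_map.simps)

text \<open>A consequence of multiplicativity and \<open>gal_map_one\<close>. It makes every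
  \<open>gal_map g\<close> bijective, so membership in the Galois group will hinge on
  multiplicativity alone.\<close>

lemma gal_map_inv:
  assumes "g \<in> carrier G"
  shows "gal_map (inv\<^bsub>G\<^esub> g) \<circ> gal_map g = id" "gal_map g \<circ> gal_map (inv\<^bsub>G\<^esub> g) = id"
  using assms by (simp_all add: gal_map_one flip: gal_map_mult)

lemma bij_gal_map: "g \<in> carrier G \<Longrightarrow> bij (gal_map g)"
  using gal_map_inv o_bij by blast

text \<open>The value at \<iota> x has A-component r x and V-component \<sigma> x, so it determines
  both.\<close>

lemma inj_on_gal_map: "inj_on gal_map (carrier G)"
proof (rule inj_onI)
  fix g h assume gh: "g \<in> carrier G" "h \<in> carrier G" and eq: "gal_map g = gal_map h"
  obtain r \<sigma> r' \<sigma>' where [simp]: "g = (r, \<sigma>)" "h = (r', \<sigma>')"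
    by (metis surj_pair)
  have "r x = r' x \<and> \<sigma> x = \<sigma>' x" for x
    using gh gal_map_\<iota>[of r \<sigma> x] gal_map_\<iota>[of r' \<sigma>' x] eq
    by (simp add: decomposition_unique carrier_G_iff)
  then show "g = h"
    by auto
qed

text \<open>Additivity reduces the condition to factors from A or from the image of \<iota>. Two
  factors from A give nothing new, because T fixes A; each of the three other cases gives one
  identity in A and one in V.\<close>

lemma gal_map_multiplicative_iff:
  assumes g: "(r, \<sigma>) \<in> carrier G"
  shows "(\<forall>b c. gal_map (r, \<sigma>) (b * c) = gal_map (r, \<sigma>) b * gal_map (r, \<sigma>) c)
    \<longleftrightarrow> (r, \<sigma>) \<in> G_AV_datum sB A sV \<Omega>"
proof -
  define T where "T = gal_map (r, \<sigma>)"
  interpret T: Vector_Spaces.linear sB sB T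
    unfolding T_def using g by (rule linear_gal_map)
  have TA: "T a = a" if "a \<in> A" for a
    using g that by (simp add: T_def gal_map_A)
  have T\<iota>: "T (\<iota> x) = r x + \<iota> (\<sigma> x)" for x
    using g by (simp add: T_def gal_map_\<iota>)
  have r [simp]: "r x \<in> A" for x
    using g by (simp add: carrier_G_iff)
  have A\<iota>: "T (a * \<iota> x) = T a * T (\<iota> x) \<longleftrightarrow>
      r (a \<rightharpoonup> x) = a * r x - a \<leftharpoonup> x + a \<leftharpoonup> \<sigma> x \<and> \<sigma> (a \<rightharpoonup> x) = a \<rightharpoonup> \<sigma> x"
    if a: "a \<in> A" for a x
  proof -
    have L: "T (a * \<iota> x) = (a \<leftharpoonup> x + r (a \<rightharpoonup> x)) + \<iota> (\<sigma> (a \<rightharpoonup> x))"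
      using a by (simp add: A_mult_\<iota> T.add TA T\<iota> add.assoc)
    have R: "T a * T (\<iota> x) = (a * r x + a \<leftharpoonup> \<sigma> x) + \<iota> (a \<rightharpoonup> \<sigma> x)"
      using a by (simp add: TA T\<iota> distrib_left A_mult_\<iota> add.assoc)
    show ?thesis
      \<comment> \<open>Uniqueness of the decomposition splits the equation into its A- and
        V-components; the rest only moves the term a \<leftharpoonup> x to the other side.\<close>
      unfolding L R using a by (subst decomposition_unique) (auto simp: algebra_simps)
  qed
  have \<iota>A: "T (\<iota> x * a) = T (\<iota> x) * T a \<longleftrightarrow>
      r (x \<triangleleft> a) = r x * a - x \<triangleright> a + \<sigma> x \<triangleright> a \<and> \<sigma> (x \<triangleleft> a) = \<sigma> x \<triangleleft> a"
    if a: "a \<in> A" for a x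
  proof -
    have L: "T (\<iota> x * a) = (x \<triangleright> a + r (x \<triangleleft> a)) + \<iota> (\<sigma> (x \<triangleleft> a))"
      using a by (simp add: \<iota>_mult_A T.add TA T\<iota> add.assoc)
    have R: "T (\<iota> x) * T a = (r x * a + \<sigma> x \<triangleright> a) + \<iota> (\<sigma> x \<triangleleft> a)"
      using a by (simp add: TA T\<iota> distrib_right \<iota>_mult_A add.assoc)
    show ?thesis
      unfolding L R using a by (subst decomposition_unique) (auto simp: algebra_simps)
  qed
  have \<iota>\<iota>: "T (\<iota> x * \<iota> y) = T (\<iota> x) * T (\<iota> y) \<longleftrightarrow>
      \<f> x y = \<f> (\<sigma> x) (\<sigma> y) + r x * r y - r (x \<cdot> y) + r x \<leftharpoonup> \<sigma> y + \<sigma> x \<triangleright> r y \<and>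
      \<sigma> (x \<cdot> y) = \<sigma> x \<cdot> \<sigma> y + r x \<rightharpoonup> \<sigma> y + \<sigma> x \<triangleleft> r y" for x y
  proof -
    have L: "T (\<iota> x * \<iota> y) = (\<f> x y + r (x \<cdot> y)) + \<iota> (\<sigma> (x \<cdot> y))"
      by (simp add: \<iota>_mult_\<iota> T.add TA T\<iota> add.assoc)
    \<comment> \<open>Expanding (r x + \<iota> (\<sigma> x)) (r y + \<iota> (\<sigma> y)) gives four
      products. The first lies in A, and each of the others is rewritten by one of the three product
      rules, which apply because r takes values in A.\<close>
    have R: "T (\<iota> x) * T (\<iota> y) =
        (\<f> (\<sigma> x) (\<sigma> y) + r x * r y + r x \<leftharpoonup> \<sigma> y + \<sigma> x \<triangleright> r y)
        + \<iota> (\<sigma> x \<cdot> \<sigma> y + r x \<rightharpoonup> \<sigma> y + \<sigma> x \<triangleleft> r y)"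
      by (simp add: T\<iota> distrib_left distrib_right A_mult_\<iota> \<iota>_mult_A \<iota>_mult_\<iota> \<iota>.add add_ac)
    show ?thesis
      unfolding L R by (subst decomposition_unique) (auto simp: algebra_simps)
  qed
  have "(\<forall>b c. T (b * c) = T b * T c) \<longleftrightarrow>
    (\<forall>a\<in>A. \<forall>x. T (a * \<iota> x) = T a * T (\<iota> x)) \<and> (\<forall>a\<in>A. \<forall>x. T (\<iota> x * a) = T (\<iota> x) * T a) \<and>
    (\<forall>x y. T (\<iota> x * \<iota> y) = T (\<iota> x) * T (\<iota> y))" (is "?L \<longleftrightarrow> ?R")
  proof
    assume ?R
    show ?L
    proof (intro allI)
      fix b c
      obtain a x where b: "a \<in> A" "b = a + \<iota> x" by (rule decomposition)
      obtain a' x' where c: "a' \<in> A" "c = a' + \<iota> x'" by (rule decomposition)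
      have "T (b * c) = T (a * a') + T (a * \<iota> x') + (T (\<iota> x * a') + T (\<iota> x * \<iota> x'))"
        by (simp add: b c distrib_left distrib_right T.add add_ac)
      also have "\<dots> = T a * T a' + T a * T (\<iota> x') + (T (\<iota> x) * T a' + T (\<iota> x) * T (\<iota> x'))"
        using \<open>?R\<close> b c by (simp add: TA)
      also have "\<dots> = T b * T c"
        by (simp add: b c distrib_left distrib_right T.add add_ac)
      finally show "T (b * c) = T b * T c" .
    qed
  qed blast
  also have "\<dots> \<longleftrightarrow> (r, \<sigma>) \<in> G_AV_datum sB A sV \<Omega>"
    using g by (simp add: A\<iota> \<iota>A \<iota>\<iota> G_AV_datum_def ball_conj_distrib all_conj_distrib conj_ac)
  finally show ?thesis
    by (simp add: T_def)
qed

text \<open>Linearity, bijectivity and the identity on A hold for every g in the group of pairs, and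
  the unit is fixed because it lies in A. What remains is multiplicativity.\<close>

lemma gal_map_in_Gal_iff:
  assumes "g \<in> carrier G"
  shows "gal_map g \<in> carrier (Gal sB A) \<longleftrightarrow> g \<in> G_AV_datum sB A sV \<Omega>"
proof -
  obtain r \<sigma> where [simp]: "g = (r, \<sigma>)"
    by (metis surj_pair)
  show ?thesis
    using assms gal_map_multiplicative_iff[of r \<sigma>] linear_gal_map[of r \<sigma>] bij_gal_map[of g]
      gal_map_A[of r \<sigma>]
    by (simp add: Gal_def)
qed

text \<open>The maps r and \<sigma> are read off as the A- and V-components of T (\<iota> x). The
  point to prove is that \<sigma> is bijective.\<close>

lemma Gal_imp_gal_map:
  assumes "T \<in> carrier (Gal sB A)"
  obtains g where "g \<in> carrier G" "gal_map g = T"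
proof
  define r where "r x = T (\<iota> x) - \<iota> (\<pi> (T (\<iota> x)))" for x
  define \<sigma> where "\<sigma> = \<pi> \<circ> T \<circ> \<iota>"
  have lin: "Vector_Spaces.linear sB sB T" and "bij T"
    using assms by (auto simp: Gal_def)
  interpret T: Vector_Spaces.linear sB sB T by (rule lin)
  \<comment> \<open>Write R (\<iota> x) as a plus an element of the image of \<iota>. Since S fixes
    a and undoes R, it sends that element to \<iota> x - a, whose projection is x. For T and its
    inverse, taken in both orders, this shows that the induced maps on V are mutually
    inverse.\<close>
  have "\<pi> (S (\<iota> (\<pi> (R (\<iota> x))))) = x"
    if "S \<circ> R = id" "S \<in> carrier (Gal sB A)" "R \<in> carrier (Gal sB A)" for S R x
  proof -
    interpret S: Vector_Spaces.linear sB sB S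
      using that by (simp add: Gal_def)
    define a where "a = R (\<iota> x) - \<iota> (\<pi> (R (\<iota> x)))"
    have "S a = a" and "\<pi> a = 0"
      using that by (simp_all add: Gal_def a_def)
    moreover have "\<iota> (\<pi> (R (\<iota> x))) = R (\<iota> x) - a"
      by (simp add: a_def)
    ultimately show ?thesis
      using pointfree_idE[OF that(1)] by (simp add: S.diff \<pi>.diff)
  qed
  from this[of "inv_into UNIV T" T] this[of T "inv_into UNIV T"]
  have "bij \<sigma>"
    using assms Gal_inv_closed[OF assms] \<open>bij T\<close>
    by (intro o_bij[of "\<pi> \<circ> inv_into UNIV T \<circ> \<iota>"])
      (auto simp: \<sigma>_def fun_eq_iff bij_is_inj bij_is_surj surj_f_inv_f)
  moreover have "Vector_Spaces.linear sV sV \<sigma>" "Vector_Spaces.linear sV sB r"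
    by (simp_all add: \<sigma>_def r_def Vector_Spaces.linear_iff \<pi>.add \<iota>.add T.add \<pi>.scale \<iota>.scale T.scale
        B.scale_right_diff_distrib B.vector_space_axioms V.vector_space_axioms)
  ultimately show g: "(r, \<sigma>) \<in> carrier G"
    by (simp add: carrier_G_iff r_def)
  show "gal_map (r, \<sigma>) = T"
  proof
    fix b
    obtain a x where b: "a \<in> A" "b = a + \<iota> x" by (rule decomposition)
    have "T a = a"
      using assms b by (simp add: Gal_def)
    then show "gal_map (r, \<sigma>) b = T b"
      using gal_map_decomposed[OF g b(1)] by (simp add: b T.add r_def \<sigma>_def)
  qed
qed

section \<open>The subgroup and its isomorphism with the Galois group\<close>

lemma datum_subgroup: "subgroup (G_AV_datum sB A sV \<Omega>) G"
proof -
  interpret Gal: group "Gal sB A" by (rule group_Gal)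
  have sub: "g \<in> carrier G" if "g \<in> G_AV_datum sB A sV \<Omega>" for g
    using that by (auto simp: G_AV_datum_def)
  \<comment> \<open>The set is the preimage of the Galois group under \<open>gal_map\<close>, so its
    closure properties are inherited without touching the six identities.\<close>
  have mem: "g \<in> G_AV_datum sB A sV \<Omega> \<longleftrightarrow> g \<in> carrier G \<and> gal_map g \<in> carrier (Gal sB A)" for g
    using gal_map_in_Gal_iff sub by blast
  show ?thesis
  proof (rule G.subgroupI)
    show "G_AV_datum sB A sV \<Omega> \<noteq> {}"
      using mem[of "\<one>\<^bsub>G\<^esub>"] Gal.one_closed by (auto simp: gal_map_one Gal_def)
    show "g \<otimes>\<^bsub>G\<^esub> h \<in> G_AV_datum sB A sV \<Omega>"
      if "g \<in> G_AV_datum sB A sV \<Omega>" "h \<in> G_AV_datum sB A sV \<Omega>" for g h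
      using that Gal.m_closed[of "gal_map g" "gal_map h"]
      by (simp add: mem gal_map_mult mult_Gal)
    show "inv\<^bsub>G\<^esub> g \<in> G_AV_datum sB A sV \<Omega>" if "g \<in> G_AV_datum sB A sV \<Omega>" for g
    proof -
      have "gal_map (inv\<^bsub>G\<^esub> g) = inv_into UNIV (gal_map g)"
        using gal_map_inv[of g] that by (simp add: mem inv_unique_comp)
      then show ?thesis
        using that Gal_inv_closed by (simp add: mem)
    qed
  qed (use sub in blast)
qed

lemma gal_map_iso: "gal_map \<in> iso (G\<lparr>carrier := G_AV_datum sB A sV \<Omega>\<rparr>) (Gal sB A)"
proof (rule isoI)
  have sub: "G_AV_datum sB A sV \<Omega> \<subseteq> carrier G"
    by (rule subgroup.subset[OF datum_subgroup])
  show "gal_map \<in> hom (G\<lparr>carrier := G_AV_datum sB A sV \<Omega>\<rparr>) (Gal sB A)"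
  proof (rule homI)
    show "gal_map g \<in> carrier (Gal sB A)"
      if "g \<in> carrier (G\<lparr>carrier := G_AV_datum sB A sV \<Omega>\<rparr>)" for g
      using that sub gal_map_in_Gal_iff[of g] by auto
    show "gal_map (g \<otimes>\<^bsub>G\<lparr>carrier := G_AV_datum sB A sV \<Omega>\<rparr>\<^esub> h) = gal_map g \<otimes>\<^bsub>Gal sB A\<^esub> gal_map h"
      if "g \<in> carrier (G\<lparr>carrier := G_AV_datum sB A sV \<Omega>\<rparr>)"
        "h \<in> carrier (G\<lparr>carrier := G_AV_datum sB A sV \<Omega>\<rparr>)" for g h
      using that sub gal_map_mult[of g h] by (auto simp: mult_Gal)
  qed
  have "gal_map ` G_AV_datum sB A sV \<Omega> = carrier (Gal sB A)"
    using Gal_imp_gal_map gal_map_in_Gal_iff sub by (auto simp: image_iff) metis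
  then show "bij_betw gal_map (carrier (G\<lparr>carrier := G_AV_datum sB A sV \<Omega>\<rparr>)) (carrier (Gal sB A))"
    using inj_on_subset[OF inj_on_gal_map sub] by (simp add: bij_betw_def)
qed

end

section \<open>From the isomorphism with the unified product to a split extension\<close>

lemma bilinear_on_zero:
  assumes "bilinear_on sX X sY Y sZ Z h"
  shows "0 \<in> X \<Longrightarrow> y \<in> Y \<Longrightarrow> h 0 y = 0" "x \<in> X \<Longrightarrow> 0 \<in> Y \<Longrightarrow> h x 0 = 0"
proof -
  show "h 0 y = 0" if "0 \<in> X" "y \<in> Y"
  proof -
    have "h (0 + 0) y = h 0 y + h 0 y"
      using assms that unfolding bilinear_on_def by blast
    then show ?thesis by simp
  qed
  show "h x 0 = 0" if "x \<in> X" "0 \<in> Y"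
  proof -
    have "h x (0 + 0) = h x 0 + h x 0"
      using assms that unfolding bilinear_on_def by blast
    then show ?thesis by simp
  qed
qed

text \<open>Each required equation in B is checked after applying the injective map \<phi>. There,
  elements of A become (a, 0) and sections become (0, x), so the product formula collapses to the
  stated terms.\<close>

lemma split_extension_of_iso:
  fixes sB :: "'k::field \<Rightarrow> 'b::{ring,monoid_mult} \<Rightarrow> 'b" and sV :: "'k \<Rightarrow> 'v::ab_group_add \<Rightarrow> 'v"
    and \<Omega> :: "('b, 'v) extending_datum" (structure)
  assumes "assoc_unital_algebra sB"
    and subalg: "assoc_unital_algebra.unital_subalgebra sB A"
    and "vector_space sV"
    and datum: "is_extending_datum sB A sV \<Omega>"
    and iso: "unified_product_iso sB A sV \<Omega> \<phi>"
    and \<phi>_A: "\<And>a. a \<in> A \<Longrightarrow> \<phi> a = (a, 0)"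
  shows "split_extension sB sV A \<Omega> (\<lambda>x. inv_into UNIV \<phi> (0, x)) (\<lambda>b. snd (\<phi> b))"
proof -
  interpret B: assoc_unital_algebra sB by fact
  interpret V: vector_space sV by fact
  have A: "B.subspace A" "1 \<in> A" "\<And>a b. a \<in> A \<Longrightarrow> b \<in> A \<Longrightarrow> a * b \<in> A"
    using subalg by (auto simp: B.unital_subalgebra_def)
  \<comment> \<open>Membership of 0 places (0, x) in the range of \<phi>, so that the section is a
    genuine preimage.\<close>
  have A0: "0 \<in> A"
    using A(1) by (rule B.subspace_0)
  have lin: "Vector_Spaces.linear sB (\<lambda>c (a, x). (sB c a, sV c x)) \<phi>"
    and bij: "bij_betw \<phi> UNIV (A \<times> UNIV)"
    and \<phi>_mult: "\<phi> (b * c) = \<phi> b \<otimes>\<^bsub>unified_product A \<Omega>\<^esub> \<phi> c" for b c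
    using iso by (auto simp: unified_product_iso_def unified_product_def)
  interpret \<phi>: Vector_Spaces.linear sB "\<lambda>c (a, x). (sB c a, sV c x)" \<phi> by (rule lin)
  have inj: "\<phi> b = \<phi> c \<longleftrightarrow> b = c" for b c
    using bij by (auto simp: bij_betw_def inj_on_def)
  define \<iota> where "\<iota> x = inv_into UNIV \<phi> (0, x)" for x
  have \<phi>\<iota>: "\<phi> (\<iota> x) = (0, x)" for x
    unfolding \<iota>_def using bij A0 by (intro bij_betw_inv_into_right) auto
  have closed: "\<And>x a. a \<in> A \<Longrightarrow> x \<triangleright> a \<in> A" "\<And>x a. a \<in> A \<Longrightarrow> a \<leftharpoonup> x \<in> A" "\<And>x y. \<f> x y \<in> A"
    using datum by (auto simp: is_extending_datum_def bilinear_on_def)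
  \<comment> \<open>These values remove the cross terms when pairs with a zero component are
    multiplied.\<close>
  have zero [simp]: "x \<triangleright> 0 = 0" "0 \<leftharpoonup> x = 0" "x \<triangleleft> 0 = 0" "0 \<rightharpoonup> x = 0" "\<f> 0 x = 0" "\<f> x 0 = 0"
    "0 \<cdot> x = 0" "x \<cdot> 0 = 0" for x
    using datum A0 by (auto simp: is_extending_datum_def dest: bilinear_on_zero)
  have zero' [simp]: "a \<leftharpoonup> 0 = 0" "0 \<triangleright> a = 0" "a \<rightharpoonup> 0 = 0" "0 \<triangleleft> a = 0" if "a \<in> A" for a
    using datum that by (auto simp: is_extending_datum_def dest: bilinear_on_zero)
  have inv_eq: "inv_into UNIV \<phi> (0, x) = \<iota> x" for x
    by (simp add: \<iota>_def)
  show ?thesis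
    unfolding inv_eq
  proof unfold_locales
    show "B.subspace A" "1 \<in> A" "\<And>a b. a \<in> A \<Longrightarrow> b \<in> A \<Longrightarrow> a * b \<in> A"
      by (fact A)+
    show "\<And>a x. a \<in> A \<Longrightarrow> x \<triangleright> a \<in> A" "\<And>a x. a \<in> A \<Longrightarrow> a \<leftharpoonup> x \<in> A" "\<And>x y. \<f> x y \<in> A"
      by (fact closed)+
    show "\<iota> (x + y) = \<iota> x + \<iota> y" "\<iota> (sV c x) = sB c (\<iota> x)" for x y c
      by (simp_all add: \<phi>.add \<phi>.scale \<phi>\<iota> flip: inj)
    show "snd (\<phi> (b + c)) = snd (\<phi> b) + snd (\<phi> c)" for b c
      by (simp add: \<phi>.add)
    show "snd (\<phi> (sB c b)) = sV c (snd (\<phi> b))" for c b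
      by (simp add: \<phi>.scale split_beta)
    show "snd (\<phi> a) = 0" if "a \<in> A" for a
      using that by (simp add: \<phi>_A)
    show "snd (\<phi> (\<iota> x)) = x" for x
      by (simp add: \<phi>\<iota>)
    show "b - \<iota> (snd (\<phi> b)) \<in> A" for b
    proof -
      \<comment> \<open>The candidate for the A-component of b is \<open>fst (\<phi> b)\<close>,
        regarded as an element of B; it equals \<open>b - \<iota> (snd (\<phi> b))\<close> because
        both have the same image under \<phi>.\<close>
      have "fst (\<phi> b) \<in> A"
        using bij by (metis UNIV_I bij_betwE mem_Times_iff)
      moreover from this have "\<phi> (b - \<iota> (snd (\<phi> b))) = \<phi> (fst (\<phi> b))"
        by (simp add: \<phi>.diff \<phi>\<iota> \<phi>_A prod_eq_iff)
      ultimately show ?thesis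
        by (simp add: inj)
    qed
    show "a * \<iota> x = a \<leftharpoonup> x + \<iota> (a \<rightharpoonup> x)" if "a \<in> A" for a x
      using that by (simp add: \<phi>_mult \<phi>.add \<phi>\<iota> \<phi>_A closed unified_product_def flip: inj)
    show "\<iota> x * a = x \<triangleright> a + \<iota> (x \<triangleleft> a)" if "a \<in> A" for a x
      using that by (simp add: \<phi>_mult \<phi>.add \<phi>\<iota> \<phi>_A closed unified_product_def flip: inj)
    show "\<iota> x * \<iota> y = \<f> x y + \<iota> (x \<cdot> y)" for x y
      using A0 by (simp add: \<phi>_mult \<phi>.add \<phi>\<iota> \<phi>_A closed unified_product_def flip: inj)
  qed
qed

theorem corollary2p1:
  fixes sB :: "'k::field \<Rightarrow> 'b::{ring,monoid_mult} \<Rightarrow> 'b"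
    and A :: "'b set"
    and sV :: "'k \<Rightarrow> 'v::ab_group_add \<Rightarrow> 'v"
    and \<Omega> :: "('b, 'v) extending_datum"
  assumes "assoc_unital_algebra sB"
    and "assoc_unital_algebra.unital_subalgebra sB A"
    and "vector_space sV"
    and "algebra_extending_structure sB A sV \<Omega>"
    and "\<exists>\<phi>. unified_product_iso sB A sV \<Omega> \<phi> \<and> (\<forall>a\<in>A. \<phi> a = (a, 0))"
  shows "is_semidirect_product (G_AV sB A sV)
           ({\<lambda>_. 0} \<times> GL_V sV) (Hom_VA sB A sV \<times> {id}) \<and>
         subgroup (G_AV_datum sB A sV \<Omega>) (G_AV sB A sV) \<and>
         group (Gal sB A) \<and>
         Gal sB A \<cong> (G_AV sB A sV)\<lparr>carrier := G_AV_datum sB A sV \<Omega>\<rparr>"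
proof -
  obtain \<phi> where \<phi>: "unified_product_iso sB A sV \<Omega> \<phi>" "\<And>a. a \<in> A \<Longrightarrow> \<phi> a = (a, 0)"
    using assms(5) by blast
  interpret split_extension sB sV A \<Omega> "\<lambda>x. inv_into UNIV \<phi> (0, x)" "\<lambda>b. snd (\<phi> b)"
    using assms(1-4) \<phi> by (intro split_extension_of_iso) (simp_all add: algebra_extending_structure_def)
  \<comment> \<open>The map \<open>gal_map\<close> runs from pairs to automorphisms, opposite to the
    claim; reversing the isomorphism uses that its source is a group.\<close>
  have "group (G\<lparr>carrier := G_AV_datum sB A sV \<Omega>\<rparr>)"
    by (rule G.subgroup_imp_group[OF datum_subgroup])
  then have "Gal sB A \<cong> G\<lparr>carrier := G_AV_datum sB A sV \<Omega>\<rparr>"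
    by (rule group.iso_sym[OF _ is_isoI[OF gal_map_iso]])
  then show ?thesis
    using semidirect_product_G datum_subgroup group_Gal by blast
qed

end
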